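(* Let $a,d$ be positive integers with $1\leq a\leq d+2$, where $d=2^s-2^t$ for integers $t\geq \log_2(a)$ and $s\geq t+4$. Then for all $n\geq 1$, \[ \Delta_d^{(a,-,-)}(2^t n) := q_d^{(a)}(2^t n) - Q_d^{(a,-,-)}(2^t n) \geq 0 . \]
   Context: For positive integers $a,d,n$, $q_d^{(a)}(n)$ denotes the number of partitions of $n$ in which every part is at least $a$ and any two parts differ by at least $d$. For $1\le b\le d+2$, $Q_d^{(b,-,-)}(n)$ denotes the number of partitions of $n$ into parts congruent to $\pm b \pmod{d+3}$, where the parts $b$ and $d+3-b$ are not allowed. *)

theory Defs
  imports Complex_Main "HOL-Library.Multiset" "HOL-Number_Theory.Cong"
begin

definition partitions :: "nat \<Rightarrow> nat multiset set" where
  "partitions n = {p. (\<forall>x\<in>#p. 0 < x) \<and> sum_mset p = n}"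

text \<open>Finiteness makes the use of \<^const>\<open>card\<close> below meaningful.\<close>

lemma finite_partitions: "finite (partitions n)"
proof -
  have "partitions n \<subseteq> mset ` {xs. set xs \<subseteq> {..n} \<and> length xs \<le> n}"
  proof
    fix p assume p: "p \<in> partitions n"
    obtain xs where xs: "p = mset xs" using ex_mset by metis
    have pos: "\<forall>x\<in>set xs. 0 < x" and sum: "sum_list xs = n"
      using p by (auto simp: partitions_def xs sum_mset_sum_list)
    have "length xs \<le> sum_list xs" using pos by (induction xs) auto
    moreover have "set xs \<subseteq> {..n}" using sum member_le_sum_list by auto
    ultimately show "p \<in> mset ` {xs. set xs \<subseteq> {..n} \<and> length xs \<le> n}"
      using xs sum by auto
  qed
  then show ?thesis
    by (rule finite_subset) (intro finite_imageI finite_lists_length_le finite_atMost)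
qed

text \<open>Removing one copy of \<open>x\<close> before choosing \<open>y\<close> lets \<open>x\<close>, \<open>y\<close> range over all pairs of
  parts at different positions, so that repeated parts count as differing by 0.\<close>

definition q :: "nat \<Rightarrow> nat \<Rightarrow> nat \<Rightarrow> nat" where
  "q d a n = card {p \<in> partitions n.
     (\<forall>x\<in>#p. a \<le> x) \<and> (\<forall>x\<in>#p. \<forall>y\<in>#p - {#x#}. int d \<le> \<bar>int x - int y\<bar>)}"

text \<open>The two minus signs of \<open>Q\<^sub>d\<^sup>(\<^sup>b\<^sup>,\<^sup>-\<^sup>,\<^sup>-\<^sup>)\<close> stand for the exclusion of the parts \<open>b\<close> and \<open>d + 3 - b\<close>.
  The function is intended for \<open>1 \<le> b \<le> d + 2\<close>, where the subtraction does not truncate.\<close>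

definition Q_mm :: "nat \<Rightarrow> nat \<Rightarrow> nat \<Rightarrow> nat" where
  "Q_mm d b n = card {p \<in> partitions n. \<forall>x\<in>#p.
     ([int x = int b] (mod int (d + 3)) \<or> [int x = - int b] (mod int (d + 3))) \<and>
     x \<noteq> b \<and> x \<noteq> d + 3 - b}"

definition Delta_mm :: "nat \<Rightarrow> nat \<Rightarrow> nat \<Rightarrow> int" where
  "Delta_mm d a n = int (q d a n) - int (Q_mm d a n)"

end

theory Submission
  imports Defs "HOL-Library.Nat_Bijection"
begin

text \<open>
  Write \<open>d = 2\<^sup>t e\<close> with \<open>e = 2\<^sup>r - 1\<close>, \<open>r \<ge> 4\<close>. Multiplying by \<open>2\<^sup>t \<ge> a\<close> turns partitions of \<open>n\<close> with
  gaps at least \<open>e\<close> into partitions counted by \<open>q\<^sub>d\<^sup>(\<^sup>a\<^sup>)(2\<^sup>t n)\<close>, so it is enough to inject the partitions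
  counted by \<open>Q\<close> into those.

  The parts allowed in \<open>Q\<close>, listed increasingly and divided by \<open>2\<^sup>t\<close>, dominate the numbers
  \<open>1, e + 2, e + 4, e + 8, 2e + 1, 3e + 2, 3e + 4, 3e + 8, \<dots>\<close>; replacing the former by the latter,
  forgetting the smallest allowed part, and filling up with ones loses no information, because the
  multiplicity of the forgotten part is determined by the total. These numbers lie in
  \<open>B - 2B\<close>, where \<open>B = {2\<^sup>i + ek | i < r}\<close> is closed under doubling, so by Euler's argument (binary
  expansion of multiplicities) one obtains partitions into distinct parts from \<open>B\<close>.

  Finally, partitions into distinct parts from \<open>B\<close> inject into partitions with gaps at least
  \<open>e\<close>: the residue classes \<open>c = 2\<^sup>i\<close> are processed by increasing \<open>i\<close>, and the parts \<open>ek + c\<close> of a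
  class by increasing \<open>k\<close>. If \<open>k\<close> is less than the current number of parts, \<open>e\<close> is added to the \<open>k\<close>
  largest parts and \<open>c\<close> to the next one; otherwise a new part \<open>e(k - m) + c\<close> is placed below the \<open>m\<close>
  largest parts, which grow by \<open>e\<close>, for the least \<open>m\<close> that keeps the gap below it. The residues
  modulo \<open>e\<close> tell untouched, enlarged and new parts apart, which makes the process reversible.
\<close>

section \<open>Gapped lists, residues and the effect of a single key\<close>

definition gapped :: "nat \<Rightarrow> nat list \<Rightarrow> bool" where
  "gapped d = sorted_wrt (\<lambda>x y. y + d \<le> x)"

text \<open>The residue is taken in \<open>{1..d}\<close>: the largest subset sum of the powers \<open>2\<^sup>i\<close> is \<open>d\<close> itself.\<close>

definition res :: "nat \<Rightarrow> nat \<Rightarrow> nat" where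
  "res d v = Suc ((v - 1) mod d)"

definition low :: "nat \<Rightarrow> nat \<Rightarrow> nat list \<Rightarrow> bool" where
  "low d b xs \<longleftrightarrow> (\<forall>v\<in>set xs. 0 < v \<and> res d v < b)"

fun merge_key :: "nat \<Rightarrow> nat \<Rightarrow> nat \<Rightarrow> nat list \<Rightarrow> nat list" where
  "merge_key d c k [] = []"
| "merge_key d c 0 (v # vs) = (v + c) # vs"
| "merge_key d c (Suc k) (v # vs) = (v + d) # merge_key d c k vs"

text \<open>Each part passed over gains \<open>d\<close> and the new part loses \<open>d\<close> in
  exchange. For \<open>length xs \<le> k\<close>, the only case \<open>add_key\<close> uses,
  \<open>k - 1\<close> never truncates.\<close>

fun insert_key :: "nat \<Rightarrow> nat \<Rightarrow> nat \<Rightarrow> nat list \<Rightarrow> nat list" where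
  "insert_key d c k [] = [d * k + c]"
| "insert_key d c k (v # vs) =
    (if v + d \<le> d * k + c then (d * k + c) # v # vs else (v + d) # insert_key d c (k - 1) vs)"

definition add_key :: "nat \<Rightarrow> nat \<Rightarrow> nat \<Rightarrow> nat list \<Rightarrow> nat list" where
  "add_key d c k xs = (if k < length xs then merge_key d c k xs else insert_key d c k xs)"

text \<open>Every residue above \<open>c\<close> or equal to \<open>c\<close> was produced by a key smaller than \<open>k\<close>; hence the last
  key added can be read off as the bottommost enlarged part or the topmost new part.\<close>

fun bounded_by :: "nat \<Rightarrow> nat \<Rightarrow> nat \<Rightarrow> nat list \<Rightarrow> bool" where
  "bounded_by d c k [] \<longleftrightarrow> True"
| "bounded_by d c k (v # vs) \<longleftrightarrow>
    (c < res d v \<longrightarrow> 0 < k) \<and> (res d v = c \<longrightarrow> v < d * k + c) \<and> bounded_by d c (k - 1) vs"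

section \<open>Sums and gaps after adding a key\<close>

lemma length_merge_key [simp]: "length (merge_key d c k xs) = length xs"
  by (induction d c k xs rule: merge_key.induct) auto

lemma length_insert_key [simp]: "length (insert_key d c k xs) = Suc (length xs)"
  by (induction d c k xs rule: insert_key.induct) auto

lemma sum_merge_key:
  "k < length xs \<Longrightarrow> sum_list (merge_key d c k xs) = sum_list xs + (d * k + c)"
  by (induction d c k xs rule: merge_key.induct) auto

lemma sum_insert_key:
  "length xs \<le> k \<Longrightarrow> sum_list (insert_key d c k xs) = sum_list xs + (d * k + c)"
proof (induction d c k xs rule: insert_key.induct)
  case (2 d c k v vs)
  then obtain k' where k: "k = Suc k'" by (cases k) auto
  then show ?case using 2 by auto
qed auto

lemma sum_add_key: "sum_list (add_key d c k xs) = sum_list xs + (d * k + c)"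
  by (simp add: add_key_def sum_merge_key sum_insert_key)

lemma merge_key_le:
  assumes "c \<le> d" "\<And>y. y \<in> set xs \<Longrightarrow> y \<le> b" "y \<in> set (merge_key d c k xs)"
  shows "y \<le> b + d"
  using assms
proof (induction d c k xs arbitrary: y rule: merge_key.induct)
  case (2 d c v vs)
  show ?case using "2.prems"(1,3) "2.prems"(2)[of y] "2.prems"(2)[of v] by auto
next
  case (3 d c k v vs)
  show ?case using "3.prems"(1,3) "3.prems"(2)[of v] "3.IH"[OF "3.prems"(1)] "3.prems"(2)
    by auto
qed auto

text \<open>A part that is followed by altered parts gains \<open>d\<close> itself, and by
  \<open>c \<le> d\<close> nothing below it gains more.\<close>

lemma gapped_merge_key:
  assumes "c \<le> d" "gapped d xs" shows "gapped d (merge_key d c k xs)"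
  using assms
proof (induction d c k xs rule: merge_key.induct)
  case (2 d c v vs) then show ?case by (fastforce simp: gapped_def)
next
  case (3 d c k v vs)
  have "y + d \<le> v + d" if "y \<in> set (merge_key d c k vs)" for y
  proof (cases vs)
    case Nil with that show ?thesis by simp
  next
    case (Cons w ws)
    have "d \<le> v" using 3 Cons by (auto simp: gapped_def)
    then show ?thesis
      using merge_key_le[OF 3(2) _ that, of "v - d"] 3(3)
      by (fastforce simp: gapped_def)
  qed
  then show ?case using 3 by (auto simp: gapped_def)
qed (auto simp: gapped_def)

lemma insert_key_le:
  assumes "\<And>y. y \<in> set xs \<Longrightarrow> y + d \<le> b" "d * k + c \<le> b" "y \<in> set (insert_key d c k xs)"
  shows "y \<le> b"
  using assms
proof (induction d c k xs arbitrary: y rule: insert_key.induct)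
  case (2 d c k v vs)
  have "d * (k - 1) \<le> d * k" by simp
  then have le: "d * (k - 1) + c \<le> b" using "2.prems"(2) by linarith
  show ?case
  proof (cases "v + d \<le> d * k + c")
    case True
    then show ?thesis using "2.prems"(2,3) "2.prems"(1)[of y] by auto
  next
    case False
    then show ?thesis using "2.prems"(3) "2.prems"(1) "2.IH"[OF False _ le] by auto
  qed
qed auto

lemma gapped_insert_key:
  assumes "length xs \<le> k" "gapped d xs" shows "gapped d (insert_key d c k xs)"
  using assms
proof (induction d c k xs rule: insert_key.induct)
  case (2 d c k v vs)
  then obtain k' where k: "k = Suc k'" by (cases k) auto
  show ?case
  proof (cases "v + d \<le> d * k + c")
    case True
    then show ?thesis using "2.prems" by (fastforce simp: gapped_def)
  next
    case False
    \<comment> \<open>The failed comparison says \<open>d * k + c < v + d\<close>, so the value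
      passed down, \<open>d * k' + c\<close>, lies below \<open>v\<close>.\<close>
    have "y \<le> v" if "y \<in> set (insert_key d c k' vs)" for y
      using insert_key_le[OF _ _ that, of v] False "2.prems" k by (auto simp: gapped_def)
    then show ?thesis using 2 False k by (auto simp: gapped_def)
  qed
qed (auto simp: gapped_def)

lemma gapped_add_key: "c \<le> d \<Longrightarrow> gapped d xs \<Longrightarrow> gapped d (add_key d c k xs)"
  by (simp add: add_key_def gapped_merge_key gapped_insert_key)

section \<open>Arithmetic of residues\<close>

lemma res_add_period [simp]: "0 < v \<Longrightarrow> res d (v + d) = res d v"
  by (cases v) (auto simp: res_def)

lemma res_pos: "0 < res d v"
  by (simp add: res_def)

text \<open>No wrap-around occurs: \<open>(v - 1) mod d + c\<close> is at most
  \<open>2 * c - 2\<close>, which is less than \<open>d\<close>.\<close>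

lemma res_add: "0 < v \<Longrightarrow> res d v < c \<Longrightarrow> 2 * c \<le> Suc d \<Longrightarrow> res d (v + c) = res d v + c"
proof (cases v)
  case (Suc u)
  assume a: "0 < v" "res d v < c" "2 * c \<le> Suc d"
  have "(u + c) mod d = (u mod d + c) mod d" by (simp add: mod_simps)
  also have "\<dots> = u mod d + c" using a Suc by (simp add: res_def)
  finally show ?thesis using Suc by (simp add: res_def)
qed simp

lemma res_key [simp]: "0 < c \<Longrightarrow> c \<le> d \<Longrightarrow> res d (d * k + c) = c"
proof -
  assume a: "0 < c" "c \<le> d"
  obtain b where "c = Suc b" using a by (cases c) auto
  then show ?thesis using a by (simp add: res_def)
qed

text \<open>Both sides have residue \<open>c\<close>, so a strict inequality between them already
  leaves a gap of \<open>d\<close>.\<close>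

lemma res_eq_lt:
  assumes "0 < v" "res d v = c" "v < d * k + c" shows "v + d \<le> d * k + c"
proof -
  define j where "j = (v - 1) div d"
  have "v - 1 = d * j + (v - 1) mod d" by (simp add: j_def)
  then have v: "v = d * j + c" using assms by (simp add: res_def)
  then have "d * j < d * k" using assms by simp
  then have "j < k" by simp
  then have "d * Suc j \<le> d * k" by (intro mult_le_mono2) simp
  then show ?thesis using v by simp
qed

section \<open>Consequences of the bound on earlier keys\<close>

lemma bounded_by_mono: "bounded_by d c k xs \<Longrightarrow> k \<le> k' \<Longrightarrow> bounded_by d c k' xs"
proof (induction d c k xs arbitrary: k' rule: bounded_by.induct)
  case (2 d c k v vs)
  have "d * k \<le> d * k'" using 2 by simp
  then have "v < d * k + c \<Longrightarrow> v < d * k' + c" by linarith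
  moreover have "bounded_by d c (k' - 1) vs" using 2 by auto
  ultimately show ?case using 2 by auto
qed auto

lemma low_bounded_by: "low d c xs \<Longrightarrow> bounded_by d c k xs"
  by (induction d c k xs rule: bounded_by.induct) (auto simp: low_def)

text \<open>Truncation keeps the bound at \<open>0\<close> along the whole list, which excludes
  residues above \<open>c\<close>; residue \<open>c\<close> would force \<open>v < c\<close>
  although \<open>res d v \<le> v\<close>.\<close>

lemma bounded_by_0:
  "\<forall>v\<in>set xs. 0 < v \<Longrightarrow> bounded_by d c 0 xs \<Longrightarrow> low d c xs"
proof (induction xs)
  case (Cons v vs)
  have "res d v \<noteq> c"
  proof
    assume "res d v = c"
    moreover have "res d v \<le> v"
      using mod_less_eq_dividend[of "v - 1" d] Cons.prems(1) by (cases v) (auto simp: res_def)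
    ultimately show False using Cons.prems(2) by auto
  qed
  then show ?case using Cons by (auto simp: low_def)
qed (simp add: low_def)

section \<open>Processing the keys of one residue class reversibly\<close>

locale colour =
  fixes d c :: nat
  assumes c_pos: "0 < c" and c_le: "2 * c \<le> Suc d"
begin

lemma c_le_d: "c \<le> d" using c_pos c_le by linarith

text \<open>The bound drops by one per position and is \<open>0\<close> at position
  \<open>k\<close>, so the part there has residue below \<open>c\<close>, and adding
  \<open>c\<close> keeps it below \<open>2 * c\<close>.\<close>

lemma merge_key_low:
  assumes "low d (2 * c) xs" "bounded_by d c k xs"
  shows "low d (2 * c) (merge_key d c k xs)"
  using assms
proof (induction k arbitrary: xs)
  case 0
  show ?case
  proof (cases xs)
    case (Cons v vs)
    then have "low d c xs" using 0 bounded_by_0[of xs d c] by (auto simp: low_def)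
    then show ?thesis using Cons 0 c_le by (auto simp: low_def res_add)
  qed (simp add: low_def)
next
  case (Suc k)
  show ?case
  proof (cases xs)
    case (Cons v vs)
    then have "low d (2 * c) (merge_key d c k vs)"
      using Suc.prems by (intro Suc.IH) (auto simp: low_def)
    then show ?thesis using Cons Suc.prems by (auto simp: low_def)
  qed (simp add: low_def)
qed

text \<open>The part at position \<open>k\<close> gets a residue above \<open>c\<close>, which the
  bound \<open>Suc k\<close> just permits there; the gain \<open>d\<close> of the larger parts
  matches the step from \<open>k\<close> to \<open>Suc k\<close>.\<close>

lemma bounded_by_merge_key:
  assumes "\<forall>v\<in>set xs. 0 < v" "bounded_by d c k xs"
  shows "bounded_by d c (Suc k) (merge_key d c k xs)"
  using assms
proof (induction k arbitrary: xs)
  case 0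
  show ?case
  proof (cases xs)
    case (Cons v vs)
    then have "low d c xs" using 0 bounded_by_0[of xs d c] by auto
    then have "res d (v + c) \<noteq> c" using Cons 0 c_le by (auto simp: low_def res_add res_pos)
    then show ?thesis using Cons 0 by auto
  qed simp
next
  case (Suc k)
  show ?case
  proof (cases xs)
    case (Cons v vs)
    then have "bounded_by d c (Suc k) (merge_key d c k vs)"
      using Suc.prems by (intro Suc.IH) auto
    then show ?thesis using Cons Suc.prems by auto
  qed simp
qed

text \<open>Adding \<open>c\<close> lifts a residue from below \<open>c\<close> to above
  \<open>c\<close>, skipping \<open>c\<close> itself. This tells merges from insertions, which
  always leave a part of residue \<open>c\<close>.\<close>

lemma merge_key_no_key:
  assumes "\<forall>v\<in>set xs. 0 < v \<and> res d v \<noteq> c" "bounded_by d c k xs"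
  shows "\<forall>v\<in>set (merge_key d c k xs). res d v \<noteq> c"
  using assms
proof (induction k arbitrary: xs)
  case 0
  show ?case
  proof (cases xs)
    case (Cons v vs)
    then have "low d c xs" using 0 bounded_by_0[of xs d c] by auto
    then have "res d (v + c) \<noteq> c" using Cons 0 c_le by (auto simp: low_def res_add res_pos)
    then show ?thesis using Cons 0 by auto
  qed simp
next
  case (Suc k)
  show ?case
  proof (cases xs)
    case (Cons v vs)
    then have "\<forall>v\<in>set (merge_key d c k vs). res d v \<noteq> c"
      using Suc.prems by (intro Suc.IH) auto
    then show ?thesis using Cons Suc.prems by auto
  qed simp
qed

lemma merge_key_not_low:
  assumes "\<forall>v\<in>set xs. 0 < v" "bounded_by d c k xs" "k < length xs"
  shows "\<not> low d c (merge_key d c k xs)"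
  using assms
proof (induction k arbitrary: xs)
  case 0
  then obtain v vs where Cons: "xs = v # vs" by (cases xs) auto
  then have "low d c xs" using 0 bounded_by_0[of xs d c] by auto
  then show ?case using Cons c_le by (auto simp: low_def res_add)
next
  case (Suc k)
  then obtain v vs where Cons: "xs = v # vs" by (cases xs) auto
  then have "\<not> low d c (merge_key d c k vs)"
    using Suc.prems by (intro Suc.IH) auto
  then show ?case using Cons by (auto simp: low_def)
qed

text \<open>The key is legible as a position: the part at \<open>k\<close> has residue above
  \<open>c\<close>, and everything after it is \<open>low d c\<close>.\<close>

lemma merge_key_inj:
  assumes "\<forall>v\<in>set xs. 0 < v" "bounded_by d c k xs" "k < length xs"
    and "\<forall>v\<in>set xs'. 0 < v" "bounded_by d c k' xs'" "k' < length xs'"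
    and "merge_key d c k xs = merge_key d c k' xs'"
  shows "k = k' \<and> xs = xs'"
  using assms
proof (induction k arbitrary: xs k' xs')
  case 0
  obtain v vs v' vs' where Cons: "xs = v # vs" "xs' = v' # vs'"
    using 0 by (cases xs; cases xs') auto
  have low: "low d c xs" using 0 bounded_by_0[of xs d c] by auto
  show ?case
  proof (cases k')
    case 0
    then show ?thesis using "0.prems" Cons by simp
  next
    case (Suc l)
    then have "vs = merge_key d c l vs'" using "0.prems" Cons by simp
    moreover have "\<not> low d c (merge_key d c l vs')"
      using "0.prems" Cons Suc by (intro merge_key_not_low) auto
    ultimately show ?thesis using low Cons by (auto simp: low_def)
  qed
next
  case (Suc k)
  obtain v vs v' vs' where Cons: "xs = v # vs" "xs' = v' # vs'"
    using Suc.prems by (cases xs; cases xs') auto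
  show ?case
  proof (cases k')
    case 0
    have "low d c xs'" using Suc.prems 0 bounded_by_0[of xs' d c] by auto
    moreover have "vs' = merge_key d c k vs" using Suc.prems Cons 0 by simp
    moreover have "\<not> low d c (merge_key d c k vs)"
      using Suc.prems Cons by (intro merge_key_not_low) auto
    ultimately show ?thesis using Cons by (auto simp: low_def)
  next
    case (Suc l)
    then show ?thesis using Suc.prems Cons Suc.IH[of vs vs' l] by auto
  qed
qed

lemma low_Cons [simp]: "low d b (v # vs) \<longleftrightarrow> 0 < v \<and> res d v < b \<and> low d b vs"
  by (auto simp: low_def)

lemma insert_key_low:
  assumes "low d (2 * c) xs" shows "low d (2 * c) (insert_key d c k xs)"
  using assms
proof (induction xs arbitrary: k)
  case Nil
  then show ?case using c_pos c_le_d by (simp add: low_def)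
next
  case (Cons v vs)
  then have "low d (2 * c) (insert_key d c (k - 1) vs)" by simp
  then show ?case using Cons.prems c_pos c_le_d by simp
qed

lemma insert_key_has_key:
  assumes "\<forall>v\<in>set xs. 0 < v" shows "\<exists>v\<in>set (insert_key d c k xs). res d v = c"
  using assms
proof (induction xs arbitrary: k)
  case Nil
  then show ?case using c_pos c_le_d by simp
next
  case (Cons v vs)
  then have "\<exists>v\<in>set (insert_key d c (k - 1) vs). res d v = c" by simp
  then show ?case using c_pos c_le_d by simp
qed

lemma bounded_by_insert_key:
  assumes "\<forall>v\<in>set xs. 0 < v" "bounded_by d c k xs" "length xs \<le> k"
  shows "bounded_by d c (Suc k) (insert_key d c k xs)"
  using assms
proof (induction xs arbitrary: k)
  case Nil
  then show ?case using c_pos c_le_d by simp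
next
  case (Cons v vs)
  then obtain l where k: "k = Suc l" by (cases k) auto
  have "bounded_by d c (Suc l) (insert_key d c l vs)"
    using Cons.prems k by (intro Cons.IH) auto
  then show ?case using Cons.prems k c_pos c_le_d by (simp add: add.assoc)
qed

lemma insert_key_inj:
  assumes "\<forall>v\<in>set xs. 0 < v" "bounded_by d c k xs" "length xs \<le> k"
    and "\<forall>v\<in>set xs'. 0 < v" "bounded_by d c k' xs'" "length xs' \<le> k'"
    and "insert_key d c k xs = insert_key d c k' xs'"
  shows "k = k' \<and> xs = xs'"
  using assms
proof (induction xs arbitrary: k k' xs')
  case Nil
  then have "length (insert_key d c k' xs') = 1" by (metis length_insert_key list.size(3) One_nat_def)
  then have "xs' = []" by simp
  then show ?case using Nil c_pos c_le_d by auto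
next
  case (Cons v vs)
  then have "length xs' = Suc (length vs)"
    by (metis length_insert_key length_Cons Suc_inject)
  then obtain v' vs' where Cons': "xs' = v' # vs'" by (cases xs') auto
  obtain l l' where k: "k = Suc l" "k' = Suc l'" using Cons.prems Cons' by (cases k; cases k') auto
  let ?A = "v + d \<le> d * k + c" and ?B = "v' + d \<le> d * k' + c"
  have d: "0 < d" using c_pos c_le_d by simp
  consider "?A" "?B" | "?A" "\<not> ?B" | "\<not> ?A" "?B" | "\<not> ?A" "\<not> ?B" by blast
  then show ?case
  proof cases
    case 1 then show ?thesis using Cons.prems Cons' d by auto
  next
    case 2
    \<comment> \<open>A new part coincides with an enlarged one, so \<open>v'\<close> has residue
      \<open>c\<close>. Then \<open>bounded_by\<close> puts it below \<open>d * k' + c\<close>,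
      hence lower by at least \<open>d\<close>, against \<open>\<not> ?B\<close>.\<close>
    then have "v' + d = d * k + c" using Cons.prems(7) Cons' by simp
    then have "res d v' = c" using Cons.prems(4) Cons' c_pos c_le_d
      by (metis list.set_intros(1) res_add_period res_key)
    then show ?thesis using 2 Cons.prems Cons' res_eq_lt[of v' d c k'] by auto
  next
    case 3
    then have "v + d = d * k' + c" using Cons.prems(7) Cons' by simp
    then have "res d v = c" using Cons.prems(1) c_pos c_le_d
      by (metis list.set_intros(1) res_add_period res_key)
    then show ?thesis using 3 Cons.prems res_eq_lt[of v d c k] by auto
  next
    case 4
    then show ?thesis using Cons.prems Cons' k Cons.IH[of l vs' l'] by auto
  qed
qed

text \<open>Invariant before a key \<open>k\<close> is added. The last conjunct holds because keys
  increase: an insertion needs \<open>length xs \<le> k\<close> and lengthens the list by one only,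
  so no later key is merged.\<close>

definition ready :: "nat \<Rightarrow> nat list \<Rightarrow> bool" where
  "ready k xs \<longleftrightarrow> low d (2 * c) xs \<and> bounded_by d c k xs \<and>
    (k < length xs \<longrightarrow> (\<forall>v\<in>set xs. res d v \<noteq> c))"

lemma ready_pos: "ready k xs \<Longrightarrow> \<forall>v\<in>set xs. 0 < v"
  by (auto simp: ready_def low_def)

lemma ready_mono: "ready k xs \<Longrightarrow> k \<le> k' \<Longrightarrow> ready k' xs"
  using bounded_by_mono by (auto simp: ready_def)

lemma low_ready: "low d c xs \<Longrightarrow> ready k xs"
  using low_bounded_by c_pos by (fastforce simp: ready_def low_def)

lemma ready_add_key:
  assumes "ready k xs" shows "ready (Suc k) (add_key d c k xs)"
proof (cases "k < length xs")
  case True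
  then show ?thesis
    using assms merge_key_low[of xs k] bounded_by_merge_key[of xs k] merge_key_no_key[of xs k]
      ready_pos[OF assms]
    by (simp add: ready_def add_key_def)
next
  case False
  then show ?thesis
    using assms insert_key_low[of xs k] bounded_by_insert_key[of xs k] ready_pos[OF assms]
    by (simp add: ready_def add_key_def)
qed

lemma add_key_not_low:
  assumes "ready k xs" shows "\<not> low d c (add_key d c k xs)"
proof (cases "k < length xs")
  case True
  then show ?thesis using assms merge_key_not_low[of xs k] ready_pos[OF assms]
    by (simp add: ready_def add_key_def)
next
  case False
  then show ?thesis using insert_key_has_key[of xs k] ready_pos[OF assms]
    by (auto simp: low_def add_key_def)
qed

lemma add_key_inj:
  assumes "ready k xs" "ready k' xs'" and eq: "add_key d c k xs = add_key d c k' xs'"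
  shows "k = k' \<and> xs = xs'"
proof -
  have *: False if "k < length xs" "\<not> k' < length xs'" "ready k xs" "ready k' xs'"
    "add_key d c k xs = add_key d c k' xs'" for k k' xs xs'
    using that merge_key_no_key[of xs k] insert_key_has_key[of xs' k'] ready_pos[of k xs]
      ready_pos[of k' xs'] by (auto simp: add_key_def ready_def)
  consider "k < length xs" "k' < length xs'" | "\<not> k < length xs" "\<not> k' < length xs'"
    using *[of k xs k' xs'] *[of k' xs' k xs] assms by metis
  then show ?thesis
  proof cases
    case 1
    then show ?thesis using assms merge_key_inj[of xs k xs' k'] ready_pos[of k xs] ready_pos[of k' xs']
      by (auto simp: add_key_def ready_def)
  next
    case 2
    then show ?thesis using assms insert_key_inj[of xs k xs' k'] ready_pos[of k xs] ready_pos[of k' xs']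
      by (auto simp: add_key_def ready_def)
  qed
qed

text \<open>\<open>foldr\<close> starts from the end of the list, so a decreasing \<open>ks\<close>
  feeds in the smallest key first.\<close>

definition add_keys :: "nat list \<Rightarrow> nat list \<Rightarrow> nat list" where
  "add_keys ks xs = foldr (add_key d c) ks xs"

lemma add_keys_simps [simp]:
  "add_keys [] xs = xs"
  "add_keys (k # ks) xs = add_key d c k (add_keys ks xs)"
  by (simp_all add: add_keys_def)

lemma ready_add_keys:
  assumes "low d c xs" "sorted_wrt (>) ks" "\<And>k'. k' \<in> set ks \<Longrightarrow> k' < k"
  shows "ready k (add_keys ks xs)"
  using assms
proof (induction ks arbitrary: k)
  case (Cons k' ks)
  have "ready k' (add_keys ks xs)" using Cons.prems by (intro Cons.IH) auto
  then have "ready (Suc k') (add_keys (k' # ks) xs)" by (simp add: ready_add_key)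
  moreover have "Suc k' \<le> k" using Cons.prems(3)[of k'] by simp
  ultimately show ?case by (rule ready_mono)
qed (simp add: low_ready)

text \<open>The largest key is undone first, by \<open>add_key_inj\<close>. The end of the process
  is recognisable because only the initial list is \<open>low d c\<close>.\<close>

lemma add_keys_inj:
  assumes "low d c xs" "sorted_wrt (>) ks" "low d c xs'" "sorted_wrt (>) ks'"
    and "add_keys ks xs = add_keys ks' xs'"
  shows "ks = ks' \<and> xs = xs'"
  using assms
proof (induction ks arbitrary: ks')
  case Nil
  show ?case
  proof (cases ks')
    case (Cons k' ls')
    have "ready k' (add_keys ls' xs')" using Nil Cons by (intro ready_add_keys) auto
    then show ?thesis using Nil Cons add_key_not_low by auto
  qed (use Nil in simp)
next
  case (Cons k ls)
  have r: "ready k (add_keys ls xs)" using Cons.prems by (intro ready_add_keys) auto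
  show ?case
  proof (cases ks')
    case Nil
    then show ?thesis using Cons.prems r add_key_not_low by auto
  next
    case (Cons k' ls')
    have "ready k' (add_keys ls' xs')" using Cons.prems Cons by (intro ready_add_keys) auto
    then have "k = k' \<and> add_keys ls xs = add_keys ls' xs'"
      using add_key_inj[OF r] Cons.prems(5) Cons by auto
    then show ?thesis using Cons.IH[of ls'] Cons.prems Cons by auto
  qed
qed

lemma gapped_add_keys: "gapped d xs \<Longrightarrow> gapped d (add_keys ks xs)"
  by (induction ks) (auto intro: gapped_add_key c_le_d)

lemma sum_add_keys: "sum_list (add_keys ks xs) = sum_list xs + (\<Sum>k\<leftarrow>ks. c + d * k)"
  by (induction ks) (auto simp: sum_add_key)

lemma low_add_keys:
  assumes "low d c xs" "sorted_wrt (>) ks" shows "low d (2 * c) (add_keys ks xs)"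
proof -
  \<comment> \<open>Any strict upper bound on the keys serves here; their sum plus one is such a
    bound.\<close>
  have "ready (Suc (sum_list ks)) (add_keys ks xs)"
    using assms by (intro ready_add_keys) (auto simp: member_le_sum_list less_Suc_eq_le)
  then show ?thesis by (simp add: ready_def)
qed

end

section \<open>From sets of distinct weights to gapped lists, class by class\<close>

definition weight :: "nat \<Rightarrow> nat \<times> nat \<Rightarrow> nat" where
  "weight d p = 2 ^ fst p + d * snd p"

text \<open>Induction on the number of classes: pairs with first component \<open>e\<close> become
  the keys of class \<open>2 ^ e\<close>, added to the list built from the other pairs. The bound
  \<open>low d (2 ^ e)\<close> is what the next class starts from.\<close>

theorem Andrews_injection:
  assumes "2 ^ e \<le> Suc d"
  shows "\<exists>f. inj_on f {F. finite F \<and> F \<subseteq> {..<e} \<times> UNIV} \<and>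
    (\<forall>F. finite F \<and> F \<subseteq> {..<e} \<times> UNIV \<longrightarrow>
      gapped d (f F) \<and> low d (2 ^ e) (f F) \<and> sum_list (f F) = sum (weight d) F)"
  using assms
proof (induction e)
  case 0
  have "inj_on (\<lambda>_. []) {F. finite F \<and> F \<subseteq> {..<0::nat} \<times> (UNIV :: nat set)}"
    by (simp add: inj_on_def)
  then show ?case by (intro exI[of _ "\<lambda>_. []"]) (simp add: gapped_def low_def)
next
  case (Suc e)
  interpret colour d "2 ^ e" using Suc.prems by unfold_locales auto
  have "2 ^ e \<le> Suc d" using Suc.prems by simp
  from Suc.IH[OF this] obtain f where IH:
    "inj_on f {F. finite F \<and> F \<subseteq> {..<e} \<times> UNIV} \<and>
      (\<forall>F. finite F \<and> F \<subseteq> {..<e} \<times> UNIV \<longrightarrow>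
        gapped d (f F) \<and> low d (2 ^ e) (f F) \<and> sum_list (f F) = sum (weight d) F)" ..
  note inj = conjunct1[OF IH]
  have f: "gapped d (f F) \<and> low d (2 ^ e) (f F) \<and> sum_list (f F) = sum (weight d) F"
    if "finite F" "F \<subseteq> {..<e} \<times> UNIV" for F
    using IH that by simp
  define keys where "keys F = rev (sorted_list_of_set (Pair e -` F))" for F :: "(nat \<times> nat) set"
  define old where "old F = F \<inter> {..<e} \<times> UNIV" for F :: "(nat \<times> nat) set"
  define g where "g F = add_keys (keys F) (f (old F))" for F
  have fin: "finite (Pair e -` F)" if "finite F" for F :: "(nat \<times> nat) set"
    using that by (intro finite_vimageI) (auto simp: inj_on_def)
  have keys: "sorted_wrt (>) (keys F)" for F
    by (simp add: keys_def sorted_wrt_rev)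
  have set_keys: "set (keys F) = Pair e -` F" if "finite F" for F
    using fin[OF that] by (simp add: keys_def)
  have old: "finite (old F)" "old F \<subseteq> {..<e} \<times> UNIV" if "finite F" for F
    using that by (auto simp: old_def)
  have split: "old F \<union> Pair e ` (Pair e -` F) = F" if "F \<subseteq> {..<Suc e} \<times> UNIV" for F
  proof (rule set_eqI)
    fix z
    have "z \<in> F \<Longrightarrow> fst z < Suc e" using that by auto
    then show "z \<in> old F \<union> Pair e ` (Pair e -` F) \<longleftrightarrow> z \<in> F"
      by (cases z) (auto simp: old_def less_Suc_eq)
  qed
  have "inj_on g {F. finite F \<and> F \<subseteq> {..<Suc e} \<times> UNIV}"
  proof (rule inj_onI, clarify)
    fix F G
    assume F: "finite F" "F \<subseteq> {..<Suc e} \<times> UNIV" and G: "finite G" "G \<subseteq> {..<Suc e} \<times> UNIV"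
      and "g F = g G"
    then have "add_keys (keys F) (f (old F)) = add_keys (keys G) (f (old G))" by (simp add: g_def)
    moreover have "low d (2 ^ e) (f (old F))" "low d (2 ^ e) (f (old G))"
      using f[OF old[OF F(1)]] f[OF old[OF G(1)]] by simp_all
    ultimately have eq: "keys F = keys G" "f (old F) = f (old G)"
      using add_keys_inj keys by blast+
    have "Pair e -` F = Pair e -` G" using set_keys[OF F(1)] set_keys[OF G(1)] eq(1) by metis
    moreover have "old F = old G"
      using inj_onD[OF inj eq(2)] old[OF F(1)] old[OF G(1)] by blast
    ultimately show "F = G" using split[OF F(2)] split[OF G(2)] by metis
  qed
  moreover have "gapped d (g F) \<and> low d (2 ^ Suc e) (g F) \<and> sum_list (g F) = sum (weight d) F"
    if F: "finite F" "F \<subseteq> {..<Suc e} \<times> UNIV" for F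
  proof -
    have "(\<Sum>k\<leftarrow>keys F. 2 ^ e + d * k) = (\<Sum>k\<in>Pair e -` F. 2 ^ e + d * k)"
      using set_keys[OF F(1)] sum.distinct_set_conv_list[of "keys F" "\<lambda>k. 2 ^ e + d * k"]
      by (simp add: keys_def)
    also have "\<dots> = sum (weight d) (Pair e ` (Pair e -` F))"
      by (subst sum.reindex) (auto simp: inj_on_def weight_def)
    finally have "sum_list (g F) = sum (weight d) (old F) + sum (weight d) (Pair e ` (Pair e -` F))"
      using f[OF old[OF F(1)]] by (simp add: g_def sum_add_keys)
    also have "\<dots> = sum (weight d) (old F \<union> Pair e ` (Pair e -` F))"
      using old[OF F(1)] finite_imageI[OF fin[OF F(1)], of "Pair e"]
      by (intro sum.union_disjoint[symmetric]) (auto simp: old_def simp del: image_vimage_eq)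
    also have "\<dots> = sum (weight d) F" by (simp only: split[OF F(2)])
    finally show ?thesis
      using f[OF old[OF F(1)]] gapped_add_keys low_add_keys keys by (simp add: g_def)
  qed
  ultimately show ?case by (intro exI[of _ g]) simp
qed

section \<open>Euler's binary expansion along doubling chains\<close>

lemma sum_mset_image_count:
  "(\<Sum>x\<in>#M. f x :: nat) = (\<Sum>x\<in>set_mset M. count M x * f x)"
proof (induction M)
  case (add y M)
  have "(\<Sum>x\<in>set_mset (add_mset y M). count (add_mset y M) x * f x)
      = (\<Sum>x\<in>insert y (set_mset M). count M x * f x + (if x = y then f y else 0))"
    by (intro sum.cong) auto
  also have "\<dots> = (\<Sum>x\<in>insert y (set_mset M). count M x * f x) + f y"
    by (simp add: sum.distrib)
  also have "(\<Sum>x\<in>insert y (set_mset M). count M x * f x) = (\<Sum>x\<in>set_mset M. count M x * f x)"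
    by (cases "y \<in># M") (auto simp: insert_absorb not_in_iff)
  finally show ?case using add.IH by simp
qed simp

text \<open>Doubling in the set \<open>B\<close> of weights \<open>2\<^sup>i + dk\<close>, \<open>i < r\<close>; the second case uses \<open>2\<^sup>r = d + 1\<close>.\<close>

definition dbl :: "nat \<Rightarrow> nat \<times> nat \<Rightarrow> nat \<times> nat" where
  "dbl r p = (if Suc (fst p) < r then (Suc (fst p), 2 * snd p) else (0, Suc (2 * snd p)))"

definition undoubled :: "nat \<Rightarrow> (nat \<times> nat) set" where
  "undoubled r = {..<r} \<times> UNIV - dbl r ` ({..<r} \<times> UNIV)"

lemma weight_dbl:
  assumes "2 ^ r = Suc d" "fst p < r" shows "weight d (dbl r p) = 2 * weight d p"
proof (cases "Suc (fst p) < r")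
  case False
  then have "r = Suc (fst p)" using assms by simp
  then have "2 * 2 ^ fst p = Suc d" using assms by simp
  then show ?thesis using False by (simp add: dbl_def weight_def algebra_simps)
qed (simp add: dbl_def weight_def)

lemma inj_on_dbl: "inj_on (dbl r) ({..<r} \<times> UNIV)"
  by (auto simp: inj_on_def dbl_def split: if_splits)

lemma fst_dbl_power: "fst p < r \<Longrightarrow> fst ((dbl r ^^ j) p) < r"
  by (induction j) (auto simp: dbl_def)

lemma weight_dbl_power:
  "2 ^ r = Suc d \<Longrightarrow> fst p < r \<Longrightarrow> weight d ((dbl r ^^ j) p) = 2 ^ j * weight d p"
  by (induction j) (auto simp: weight_dbl fst_dbl_power)

lemma undoubled_ne_dbl:
  assumes "p \<in> undoubled r" "fst p' < r" shows "p \<noteq> dbl r p'"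
proof
  assume "p = dbl r p'"
  then have "p \<in> dbl r ` ({..<r} \<times> UNIV)" using assms(2) by (simp add: mem_Times_iff)
  then show False using assms(1) by (simp add: undoubled_def)
qed

lemma fst_undoubled: "p \<in> undoubled r \<Longrightarrow> fst p < r"
  by (auto simp: undoubled_def)

text \<open>Cancelling \<open>dbl\<close> on both sides must end at a chain head on one side; as
  heads are not doubles, the other side ends at the same time.\<close>

lemma dbl_power_inj:
  assumes "p \<in> undoubled r" "p' \<in> undoubled r" "(dbl r ^^ j) p = (dbl r ^^ j') p'"
  shows "j = j' \<and> p = p'"
  using assms(3)
proof (induction j arbitrary: j')
  case 0
  have "j' = 0"
  proof (rule ccontr)
    assume "j' \<noteq> 0"
    then obtain l where "j' = Suc l" by (cases j') auto
    with 0 have "p = dbl r ((dbl r ^^ l) p')" by simp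
    moreover have "p \<noteq> dbl r ((dbl r ^^ l) p')"
      by (rule undoubled_ne_dbl[OF assms(1) fst_dbl_power[OF fst_undoubled[OF assms(2)]]])
    ultimately show False by contradiction
  qed
  with 0 show ?case by simp
next
  case (Suc j)
  have p: "fst ((dbl r ^^ j) p) < r" by (rule fst_dbl_power[OF fst_undoubled[OF assms(1)]])
  show ?case
  proof (cases j')
    case 0
    then have "p' = dbl r ((dbl r ^^ j) p)" using Suc.prems by simp
    then show ?thesis using undoubled_ne_dbl[OF assms(2) p] by contradiction
  next
    case (Suc l)
    have "fst ((dbl r ^^ l) p') < r" by (rule fst_dbl_power[OF fst_undoubled[OF assms(2)]])
    moreover have "dbl r ((dbl r ^^ j) p) = dbl r ((dbl r ^^ l) p')" using Suc Suc.prems by simp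
    ultimately have "(dbl r ^^ j) p = (dbl r ^^ l) p'"
      using p inj_on_eq_iff[OF inj_on_dbl[of r]] by (simp add: mem_Times_iff)
    from Suc.IH[OF this] show ?thesis using Suc by simp
  qed
qed

definition euler :: "nat \<Rightarrow> (nat \<times> nat) multiset \<Rightarrow> (nat \<times> nat) set" where
  "euler r M = (\<lambda>(p, j). (dbl r ^^ j) p) ` (SIGMA p:set_mset M. set_decode (count M p))"

lemma finite_euler: "finite (euler r M)"
  by (simp add: euler_def)

lemma in_euler_iff:
  "z \<in> euler r M \<longleftrightarrow> (\<exists>p j. p \<in># M \<and> j \<in> set_decode (count M p) \<and> z = (dbl r ^^ j) p)"
  by (simp add: euler_def image_iff Bex_def)

lemma euler_subset:
  assumes "set_mset M \<subseteq> undoubled r" shows "euler r M \<subseteq> {..<r} \<times> UNIV"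
proof
  fix z assume "z \<in> euler r M"
  then obtain p j where "p \<in># M" "z = (dbl r ^^ j) p" unfolding in_euler_iff by blast
  then have "fst z < r" using assms fst_dbl_power[OF fst_undoubled[of p r]] by auto
  then show "z \<in> {..<r} \<times> UNIV" by (simp add: mem_Times_iff)
qed

text \<open>Distinct chains are disjoint, so each binary digit of a multiplicity can be read off
  from the set.\<close>

lemma mem_euler:
  assumes "set_mset M \<subseteq> undoubled r" "p \<in> undoubled r"
  shows "(dbl r ^^ j) p \<in> euler r M \<longleftrightarrow> j \<in> set_decode (count M p)"
proof
  assume "(dbl r ^^ j) p \<in> euler r M"
  then obtain p' j' where *: "p' \<in># M" "j' \<in> set_decode (count M p')"
    and eq: "(dbl r ^^ j) p = (dbl r ^^ j') p'" unfolding in_euler_iff by blast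
  have "p' \<in> undoubled r" using assms(1) *(1) by blast
  from dbl_power_inj[OF assms(2) this eq] show "j \<in> set_decode (count M p)" using * by simp
next
  assume j: "j \<in> set_decode (count M p)"
  then have "count M p \<noteq> 0" by (intro notI) simp
  then have "p \<in># M" by (simp add: not_in_iff)
  then show "(dbl r ^^ j) p \<in> euler r M" using j unfolding in_euler_iff by blast
qed

lemma inj_on_euler: "inj_on (euler r) {M. set_mset M \<subseteq> undoubled r}"
proof (rule inj_onI, clarify)
  fix M N assume MN: "set_mset M \<subseteq> undoubled r" "set_mset N \<subseteq> undoubled r"
    and eq: "euler r M = euler r N"
  show "M = N"
  proof (rule multiset_eqI)
    fix p
    show "count M p = count N p"
    proof (cases "p \<in> undoubled r")
      case True
      then have "set_decode (count M p) = set_decode (count N p)"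
        using mem_euler[OF MN(1) True] mem_euler[OF MN(2) True] eq by blast
      then show ?thesis by (metis set_decode_inverse)
    next
      case False
      then have "p \<notin># M" "p \<notin># N" using MN by auto
      then show ?thesis by (simp add: not_in_iff)
    qed
  qed
qed

lemma sum_euler:
  assumes "2 ^ r = Suc d" "set_mset M \<subseteq> undoubled r"
  shows "sum (weight d) (euler r M) = (\<Sum>p\<in>#M. weight d p)"
proof -
  let ?S = "SIGMA p:set_mset M. set_decode (count M p)"
  have "inj_on (\<lambda>(p, j). (dbl r ^^ j) p) ?S"
  proof (rule inj_onI, clarify)
    fix p j p' j' assume "p \<in># M" "p' \<in># M" and eq: "(dbl r ^^ j) p = (dbl r ^^ j') p'"
    then have "p \<in> undoubled r" "p' \<in> undoubled r" using assms(2) by blast+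
    from dbl_power_inj[OF this eq] show "p = p' \<and> j = j'" by simp
  qed
  then have "sum (weight d) (euler r M) = (\<Sum>(p, j)\<in>?S. weight d ((dbl r ^^ j) p))"
    unfolding euler_def by (subst sum.reindex) (auto simp: case_prod_beta)
  also have "\<dots> = (\<Sum>(p, j)\<in>?S. 2 ^ j * weight d p)"
    using assms by (intro sum.cong) (auto simp: weight_dbl_power undoubled_def)
  also have "\<dots> = (\<Sum>p\<in>set_mset M. \<Sum>j\<in>set_decode (count M p). 2 ^ j * weight d p)"
    by (subst sum.Sigma) auto
  also have "\<dots> = (\<Sum>p\<in>set_mset M. set_encode (set_decode (count M p)) * weight d p)"
    by (simp only: set_encode_def sum_distrib_right)
  also have "\<dots> = (\<Sum>p\<in>#M. weight d p)"
    by (simp add: sum_mset_image_count)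
  finally show ?thesis .
qed

text \<open>Composes \<open>euler\<close> with the injection on sets. Positivity is retained since
  it later yields the lower bound \<open>a\<close> on the scaled parts.\<close>

lemma undoubled_injection:
  assumes "2 ^ r = Suc d"
  shows "\<exists>f. inj_on f {M. set_mset M \<subseteq> undoubled r} \<and>
    (\<forall>M. set_mset M \<subseteq> undoubled r \<longrightarrow>
      gapped d (f M) \<and> (\<forall>v\<in>set (f M). 0 < v) \<and> sum_list (f M) = (\<Sum>p\<in>#M. weight d p))"
proof -
  let ?E = "{F. finite F \<and> F \<subseteq> {..<r} \<times> (UNIV :: nat set)}"
  have "2 ^ r \<le> Suc d" using assms by simp
  from Andrews_injection[OF this] obtain f where IH: "inj_on f ?E \<and>
    (\<forall>F. finite F \<and> F \<subseteq> {..<r} \<times> UNIV \<longrightarrow>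
      gapped d (f F) \<and> low d (2 ^ r) (f F) \<and> sum_list (f F) = sum (weight d) F)" ..
  note inj = conjunct1[OF IH]
  have f: "gapped d (f F) \<and> low d (2 ^ r) (f F) \<and> sum_list (f F) = sum (weight d) F"
    if "finite F" "F \<subseteq> {..<r} \<times> UNIV" for F
    using IH that by simp
  have "euler r ` {M. set_mset M \<subseteq> undoubled r} \<subseteq> ?E"
    using finite_euler euler_subset by blast
  then have "inj_on (f \<circ> euler r) {M. set_mset M \<subseteq> undoubled r}"
    by (intro comp_inj_on inj_on_euler inj_on_subset[OF inj])
  moreover have "gapped d (f (euler r M)) \<and> (\<forall>v\<in>set (f (euler r M)). 0 < v) \<and>
      sum_list (f (euler r M)) = (\<Sum>p\<in>#M. weight d p)" if "set_mset M \<subseteq> undoubled r" for M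
    using f[OF finite_euler euler_subset[OF that]] sum_euler[OF assms that] by (auto simp: low_def)
  ultimately show ?thesis by (intro exI[of _ "f \<circ> euler r"]) simp
qed

section \<open>Gapped lists as multisets, and their scaling\<close>

lemma gapped_mset_diff:
  assumes "gapped d xs" "x \<in># mset xs" "y \<in># mset xs - {#x#}"
  shows "int d \<le> \<bar>int x - int y\<bar>"
  using assms
proof (induction xs)
  case (Cons v vs)
  have *: "z + d \<le> v" if "z \<in> set vs" for z using Cons.prems(1) that by (auto simp: gapped_def)
  consider "x = v" | "x \<noteq> v" "y = v" | "x \<noteq> v" "y \<noteq> v" by blast
  then show ?case
  proof cases
    case 1 then show ?thesis using Cons.prems *[of y] by auto
  next
    case 2 then show ?thesis using Cons.prems *[of x] by auto
  next
    case 3 then show ?thesis using Cons by (auto simp: gapped_def)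
  qed
qed simp

text \<open>A gapped list is decreasing, hence the sorted form of its multiset.\<close>

lemma gapped_mset_inj:
  assumes "gapped d xs" "gapped d ys" "mset xs = mset ys" shows "xs = ys"
proof -
  have "sorted (rev zs)" if "gapped d zs" for zs
    using that unfolding gapped_def sorted_wrt_rev
    by (rule sorted_wrt_mono_rel[rotated]) auto
  then have "rev xs = rev ys" using assms
    by (metis mset_rev properties_for_sort)
  then show ?thesis by simp
qed

lemma gapped_map_times: "gapped d xs \<Longrightarrow> gapped (c * d) (map ((*) c) xs)"
  unfolding gapped_def sorted_wrt_map
  by (erule sorted_wrt_mono_rel[rotated]) (metis add_mult_distrib2 mult_le_mono2)

section \<open>Coding the allowed parts; \<open>d\<close> here is the reduced gap \<open>e\<close>,
  and \<open>m\<close> is the modulus\<close>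

locale scaled_classes =
  fixes a d t m :: nat
  assumes a_pos: "1 \<le> a" and a_le: "a \<le> 2 ^ t" and d_ge: "15 \<le> d"
    and m_eq: "m = 2 ^ t * d + 3"
begin

definition allowed :: "nat set" where
  "allowed = {x. 0 < x \<and> ([int x = int a] (mod int m) \<or> [int x = - int a] (mod int m)) \<and>
    x \<noteq> a \<and> x \<noteq> m - a}"

text \<open>The weights of the codes are \<open>1, d + 2, d + 4, d + 8, 2d + 1, 3d + 2, \<dots>\<close> in the order of the
  allowed parts \<open>m + a, 2m - a, 2m + a, 3m - a, \<dots>\<close>.\<close>

definition code :: "nat \<Rightarrow> nat \<times> nat" where
  "code x = (let j = x div m in
    if x mod m = a then (if odd j then 0 else 2, j - 1)
    else if odd j then (1, j) else (3, j - 1))"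

lemma two_a_less: "2 * a < m"
proof -
  have "2 * a \<le> 2 ^ t * 2" using a_le by simp
  also have "\<dots> \<le> 2 ^ t * d" using d_ge by (intro mult_le_mono2) simp
  finally show ?thesis using m_eq by simp
qed

lemma code_simps:
  "code (j * m + a) = (if odd j then 0 else 2, j - 1)"
  "code (j * m + (m - a)) = (if odd j then (1, j) else (3, j - 1))"
proof -
  have 1: "(j * m + b) div m = j" "(j * m + b) mod m = b" if "b < m" for b
    using that by auto
  show "code (j * m + a) = (if odd j then 0 else 2, j - 1)"
    using 1[of a] two_a_less by (simp add: code_def)
  show "code (j * m + (m - a)) = (if odd j then (1, j) else (3, j - 1))"
    using 1[of "m - a"] two_a_less a_pos by (simp add: code_def)
qed

lemma allowed_cases:
  assumes "x \<in> allowed"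
  obtains j where "1 \<le> j" "x = j * m + a" | j where "1 \<le> j" "x = j * m + (m - a)"
proof -
  consider "[int x = int a] (mod int m)" | "[int x = - int a] (mod int m)"
    using assms by (auto simp: allowed_def)
  then show thesis
  proof cases
    case 1
    then have "[x = a] (mod m)" by (simp add: cong_int_iff)
    then have "x mod m = a" using two_a_less by (simp add: cong_def)
    then have x: "x = (x div m) * m + a" by (metis div_mult_mod_eq)
    have "1 \<le> x div m"
    proof (rule ccontr)
      assume "\<not> 1 \<le> x div m"
      then have "x div m = 0" by linarith
      then have "x = a" using x by (metis add_0 mult_0)
      then show False using assms by (simp add: allowed_def)
    qed
    then show thesis using x that(1) by blast
  next
    case 2
    then have "int m dvd int (x + a)" by (simp add: cong_iff_dvd_diff)
    then have "m dvd x + a" by (simp only: int_dvd_int_iff)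
    then obtain l where l: "x + a = m * l" by blast
    have "l \<noteq> 0" using l a_pos by (intro notI) auto
    \<comment> \<open>The value \<open>l = 1\<close> would give the excluded part
      \<open>m - a\<close>.\<close>
    moreover have "l \<noteq> 1" using l assms by (intro notI) (auto simp: allowed_def)
    ultimately obtain j where "l = Suc (Suc j)" by (metis One_nat_def not0_implies_Suc)
    then have "x = Suc j * m + (m - a)" using l two_a_less by (simp add: algebra_simps)
    then show thesis using that(2)[of "Suc j"] by simp
  qed
qed

lemma allowed_code_cases:
  assumes "x \<in> allowed"
  obtains (plus) i where "x = Suc i * m + a" "code x = (if even i then 0 else 2, i)"
    | (minus) i where "x = Suc i * m + (m - a)" "code x = (if even i then (1, Suc i) else (3, i))"
  using assms
proof (cases rule: allowed_cases)
  case (1 j)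
  then obtain i where i: "j = Suc i" by (cases j) auto
  have "code x = (if even i then 0 else 2, i)" by (simp only: 1 code_simps i) simp
  then show thesis using plus 1 i by blast
next
  case (2 j)
  then obtain i where i: "j = Suc i" by (cases j) auto
  have "code x = (if even i then (1, Suc i) else (3, i))" by (simp only: 2 code_simps i) simp
  then show thesis using minus 2 i by blast
qed

text \<open>The first component separates the four families of parts, and the second determines the
  part within its family.\<close>

lemma inj_on_code: "inj_on code allowed"
proof (rule inj_onI)
  fix x y assume "x \<in> allowed" "y \<in> allowed" and eq: "code x = code y"
  from this(1,2) show "x = y"
    by (elim allowed_code_cases; use eq in \<open>simp split: if_splits\<close>)
qed

text \<open>A double has an even second component, or first component \<open>0\<close> and an odd
  second one. Codes have it the other way round, and \<open>4 \<le> r\<close> makes the components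
  \<open>0\<close> to \<open>3\<close> available.\<close>

lemma code_undoubled:
  assumes "x \<in> allowed" "4 \<le> r" shows "code x \<in> undoubled r"
proof -
  have *: "(0, i) \<in> undoubled r" if "even i" for i
    using that assms(2) by (auto simp: undoubled_def dbl_def split: if_splits)
  have **: "(e, i) \<in> undoubled r" if "odd i" "0 < e" "e \<le> 3" for e i
    using that assms(2) by (auto simp: undoubled_def dbl_def split: if_splits)
  from assms(1) show ?thesis
    by (cases rule: allowed_code_cases) (simp_all add: * **)
qed

lemma weight_code:
  assumes "x \<in> allowed" shows "2 ^ t * weight d (code x) \<le> x"
  using assms
proof (cases rule: allowed_code_cases)
  case (plus i)
  have "2 ^ t * weight d (code x) \<le> 2 ^ t * (d * Suc i)"
    using d_ge by (intro mult_le_mono2) (simp add: plus(2) weight_def)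
  also have "\<dots> \<le> x" by (simp add: plus(1) m_eq algebra_simps)
  finally show ?thesis .
next
  case (minus i)
  \<comment> \<open>The summand \<open>d - 1\<close> fits because \<open>a \<le> 2 ^ t\<close> gives
    \<open>2 ^ t * (d - 1) \<le> m - a\<close>.\<close>
  have "2 ^ t * weight d (code x) \<le> 2 ^ t * (d * Suc i + (d - 1))"
    using d_ge by (intro mult_le_mono2, cases "even i"; simp add: minus(2) weight_def; arith)
  also have "\<dots> = 2 ^ t * d * Suc i + (2 ^ t * d - 2 ^ t)"
    by (simp add: distrib_left diff_mult_distrib2)
  also have "\<dots> \<le> m * Suc i + (m - a)"
    using a_le by (intro add_mono mult_le_mono1) (auto simp: m_eq)
  also have "\<dots> = x" by (simp only: minus(1) mult.commute)
  finally show ?thesis .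
qed

lemma code_eq_0:
  assumes "x \<in> allowed" shows "code x = (0, 0) \<longleftrightarrow> x = m + a"
  using assms
proof (cases rule: allowed_code_cases)
  case (plus i)
  then show ?thesis using two_a_less by (auto simp: odd_pos)
next
  case (minus i)
  have "x \<noteq> m + a"
  proof
    assume *: "x = m + a"
    have "1 * m \<le> Suc i * m" by (intro mult_le_mono1) simp
    with * minus(1) have "m - a \<le> a" by linarith
    then show False using two_a_less by linarith
  qed
  then show ?thesis using minus(2) by auto
qed

text \<open>The part \<open>m + a\<close> has the code \<open>(0, 0)\<close> of weight 1, which serves as filler.\<close>

definition codes :: "nat \<Rightarrow> nat multiset \<Rightarrow> (nat \<times> nat) multiset" where
  "codes n p = (let M = image_mset code (filter_mset (\<lambda>x. x \<noteq> m + a) p) in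
    M + replicate_mset (n - (\<Sum>c\<in>#M. weight d c)) (0, 0))"

definition allowed_partitions :: "nat \<Rightarrow> nat multiset set" where
  "allowed_partitions n = {p. set_mset p \<subseteq> allowed \<and> sum_mset p = 2 ^ t * n}"

text \<open>By \<open>weight_code\<close> the weights before filling total at most \<open>n\<close>,
  so the subtraction in \<open>codes\<close> does not truncate.\<close>

lemma sum_codes:
  assumes "p \<in> allowed_partitions n" shows "(\<Sum>c\<in>#codes n p. weight d c) = n"
proof -
  define P where "P = filter_mset (\<lambda>x. x \<noteq> m + a) p"
  have "2 ^ t * (\<Sum>x\<in>#P. weight d (code x)) = (\<Sum>x\<in>#P. 2 ^ t * weight d (code x))"
    by (simp add: sum_mset_distrib_left)
  also have "\<dots> \<le> sum_mset (image_mset (\<lambda>x. x) P)"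
    using assms by (intro sum_mset_mono weight_code) (auto simp: P_def allowed_partitions_def)
  also have "\<dots> \<le> sum_mset p"
    unfolding P_def by (metis multiset.map_ident le_add1 multiset_partition sum_mset.union)
  also have "\<dots> = 2 ^ t * n" using assms by (simp add: allowed_partitions_def)
  finally have "(\<Sum>x\<in>#P. weight d (code x)) \<le> n" by simp
  then show ?thesis
    by (simp add: codes_def Let_def P_def[symmetric] image_mset.compositionality comp_def weight_def)
qed

lemma codes_undoubled:
  assumes "p \<in> allowed_partitions n" "4 \<le> r" shows "set_mset (codes n p) \<subseteq> undoubled r"
proof -
  have "(0, 0) \<in> undoubled r" using assms(2) by (auto simp: undoubled_def dbl_def split: if_splits)
  then show ?thesis using assms code_undoubled
    by (auto simp: codes_def Let_def allowed_partitions_def split: if_splits)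
qed

text \<open>Discarding all \<open>(0, 0)\<close> leaves exactly the codes of the parts other than
  \<open>m + a\<close>; the common total then fixes the multiplicity of
  \<open>m + a\<close>.\<close>

lemma inj_on_codes: "inj_on (codes n) (allowed_partitions n)"
proof (rule inj_onI)
  fix p p' assume p: "p \<in> allowed_partitions n" "p' \<in> allowed_partitions n"
    and eq: "codes n p = codes n p'"
  define P where "P p = filter_mset (\<lambda>x. x \<noteq> m + a) p" for p
  have filter: "image_mset (inv_into allowed code) (filter_mset (\<lambda>c. c \<noteq> (0, 0)) (codes n p)) = P p"
    if "p \<in> allowed_partitions n" for p
  proof -
    have "filter_mset (\<lambda>c. c \<noteq> (0, 0)) (image_mset code (P p)) = image_mset code (P p)"
      using that code_eq_0 by (intro filter_mset_eq_conv[THEN iffD2])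
        (auto simp: P_def allowed_partitions_def)
    then have "filter_mset (\<lambda>c. c \<noteq> (0, 0)) (codes n p) = image_mset code (P p)"
      by (simp add: codes_def Let_def P_def[symmetric])
    moreover have "image_mset (inv_into allowed code \<circ> code) (P p) = image_mset id (P p)"
      using that inj_on_code by (intro image_mset_cong)
        (auto simp: P_def allowed_partitions_def inv_into_f_f)
    ultimately show ?thesis by (simp add: image_mset.compositionality)
  qed
  have P: "P p = P p'" using filter[OF p(1)] filter[OF p(2)] eq by simp
  have split: "q = P q + replicate_mset (count q (m + a)) (m + a)" for q
    by (rule multiset_eqI) (auto simp: P_def)
  have "sum_mset p = sum_mset p'" using p by (simp add: allowed_partitions_def)
  then have "sum_mset (P p) + count p (m + a) * (m + a) = sum_mset (P p') + count p' (m + a) * (m + a)"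
    using split[of p] split[of p'] by (metis sum_mset.union sum_mset_replicate_mset of_nat_id)
  then have "count p (m + a) = count p' (m + a)" using P a_pos by simp
  then show "p = p'" using P split[of p] split[of p'] by metis
qed

end

section \<open>Scaling gaps \<open>e\<close> to gaps \<open>d\<close> and comparing
  cardinalities\<close>

theorem theorem1p6:
  fixes a d s t n :: nat
  assumes "1 \<le> d"
    and "1 \<le> a" and "a \<le> d + 2"
    and "int d = 2 ^ s - 2 ^ t"
    and "log 2 (real a) \<le> real t"
    and "t + 4 \<le> s"
    and "1 \<le> n"
  shows "0 \<le> Delta_mm d a (2 ^ t * n)"
proof -
  define r where "r = s - t"
  define e where "e = (2 ^ r - 1 :: nat)"
  have s: "s = t + r" and r: "4 \<le> r" using assms by (simp_all add: r_def)
  have e: "2 ^ r = Suc e" by (simp add: e_def)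
  have "(2 :: nat) ^ 4 \<le> 2 ^ r" using r by (intro power_increasing) auto
  then have e15: "15 \<le> e" using e by simp
  have "(2 :: int) ^ r = int e + 1" using e by (metis of_nat_Suc of_nat_numeral of_nat_power add.commute)
  then have "int d = int (2 ^ t * e)" using assms(4) by (simp add: s power_add algebra_simps)
  then have d: "d = 2 ^ t * e" by (simp only: of_nat_eq_iff)
  have "real a = 2 powr (log 2 (real a))" using assms by simp
  also have "\<dots> \<le> 2 powr real t" using assms(5) by (intro powr_mono) simp_all
  also have "\<dots> = real (2 ^ t)" by (simp add: powr_realpow)
  finally have a_le: "a \<le> 2 ^ t" by (simp only: of_nat_le_iff)
  interpret scaled_classes a e t "d + 3"
    using assms a_le e15 d by unfold_locales auto
  from undoubled_injection[OF e] obtain f where F: "inj_on f {M. set_mset M \<subseteq> undoubled r} \<and>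
    (\<forall>M. set_mset M \<subseteq> undoubled r \<longrightarrow>
      gapped e (f M) \<and> (\<forall>v\<in>set (f M). 0 < v) \<and> sum_list (f M) = (\<Sum>p\<in>#M. weight e p))" ..
  note inj_f = conjunct1[OF F]
  have f: "gapped e (f M) \<and> (\<forall>v\<in>set (f M). 0 < v) \<and> sum_list (f M) = (\<Sum>p\<in>#M. weight e p)"
    if "set_mset M \<subseteq> undoubled r" for M
    using F that by simp
  define g where "g p = mset (map ((*) (2 ^ t)) (f (codes n p)))" for p
  let ?Q = "{p \<in> partitions (2 ^ t * n). \<forall>x\<in>#p.
     ([int x = int a] (mod int (d + 3)) \<or> [int x = - int a] (mod int (d + 3))) \<and>
     x \<noteq> a \<and> x \<noteq> d + 3 - a}"
  let ?q = "{p \<in> partitions (2 ^ t * n).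
     (\<forall>x\<in>#p. a \<le> x) \<and> (\<forall>x\<in>#p. \<forall>y\<in>#p - {#x#}. int d \<le> \<bar>int x - int y\<bar>)}"
  have Q: "?Q \<subseteq> allowed_partitions n"
    by (auto simp: partitions_def allowed_partitions_def allowed_def)
  have cu: "set_mset (codes n p) \<subseteq> undoubled r" if "p \<in> ?Q" for p
    by (rule codes_undoubled[OF subsetD[OF Q that] r])
  have gap: "gapped d (map ((*) (2 ^ t)) (f (codes n p)))" if "p \<in> ?Q" for p
    using gapped_map_times[of e "f (codes n p)" "2 ^ t"] f[OF cu[OF that]] unfolding d[symmetric] by blast
  have "inj_on g ?Q"
  proof (rule inj_onI)
    fix p p' assume p: "p \<in> ?Q" "p' \<in> ?Q" and eq: "g p = g p'"
    from gapped_mset_inj[OF gap[OF p(1)] gap[OF p(2)] eq[unfolded g_def]]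
    have "f (codes n p) = f (codes n p')"
      by (rule map_injective) (simp add: inj_on_def)
    then have "codes n p = codes n p'"
      using inj_on_eq_iff[OF inj_f] cu[OF p(1)] cu[OF p(2)] by simp
    then show "p = p'"
      using inj_on_eq_iff[OF inj_on_codes subsetD[OF Q p(1)] subsetD[OF Q p(2)]] by simp
  qed
  moreover have "g ` ?Q \<subseteq> ?q"
  proof (clarify, intro conjI ballI)
    fix p assume "p \<in> partitions (2 ^ t * n)" "\<forall>x\<in>#p.
     ([int x = int a] (mod int (d + 3)) \<or> [int x = - int a] (mod int (d + 3))) \<and>
     x \<noteq> a \<and> x \<noteq> d + 3 - a"
    then have p: "p \<in> ?Q" by simp
    have fp: "\<forall>v\<in>set (f (codes n p)). 0 < v" "sum_list (f (codes n p)) = n"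
      using f[OF cu[OF p]] sum_codes[OF subsetD[OF Q p]] by simp_all
    have "sum_mset (g p) = 2 ^ t * n"
      unfolding g_def sum_mset_sum_list
      using sum_list_const_mult[of "2 ^ t" "\<lambda>v. v" "f (codes n p)"] fp(2) by simp
    then show "g p \<in> partitions (2 ^ t * n)"
      using fp(1) by (auto simp: g_def partitions_def)
    show "a \<le> x" if "x \<in># g p" for x
    proof -
      obtain v where v: "v \<in> set (f (codes n p))" "x = 2 ^ t * v" using \<open>x \<in># g p\<close> by (auto simp: g_def)
      \<comment> \<open>Since \<open>v\<close> is positive, the scaled part is at least
        \<open>2 ^ t\<close>, which is at least \<open>a\<close>.\<close>
      then have "2 ^ t * 1 \<le> x" using fp by (simp only: mult_le_mono2 Suc_leI One_nat_def)
      then show ?thesis using a_le by simp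
    qed
    show "int d \<le> \<bar>int x - int y\<bar>" if "x \<in># g p" "y \<in># g p - {#x#}" for x y
      using gapped_mset_diff[OF gap[OF p]] that by (simp add: g_def)
  qed
  moreover have "finite ?q" by (simp add: finite_partitions)
  ultimately have "card ?Q \<le> card ?q" by (rule card_inj_on_le)
  then show ?thesis by (simp add: Delta_mm_def q_def Q_mm_def)
qed

end
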